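(* Let $R$ be a finite commutative ring with non-zero identity. Then the Jacobson graph $\mathfrak{J}_R$ is Eulerian if and only if either $R\cong\mathbb{Z}_2$, or $|R|$ is odd and $R/J(R)\cong\mathbb{Z}_3\oplus\cdots\oplus\mathbb{Z}_3$ is a direct sum of at least two copies of $\mathbb{Z}_3$.
   Context: All rings are commutative with a non-zero identity. For a ring $R$, $J(R)$ denotes its Jacobson radical and $U(R)$ its group of units. The Jacobson graph $\mathfrak{J}_R$ of $R$ is the simple graph with vertex set $R\setminus J(R)$ in which two distinct vertices $x,y$ are adjacent if and only if $1-xy\notin U(R)$. $\mathbb{Z}_m$ denotes the ring $\mathbb{Z}/m\mathbb{Z}$ and $\oplus$ is the direct sum (product) of rings. An Eulerian tour (circuit) in a graph is a closed walk including every edge of the graph exactly once; a graph is Eulerian if it is connected and has an Eulerian tour. The graph with a single vertex and no edges is regarded as Eulerian (via the trivial closed walk). *)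

theory Defs
  imports "HOL-Algebra.Algebra" "Graph_Theory.Graph_Theory"
begin

definition jacobson_radical :: "('a, 'm) ring_scheme \<Rightarrow> 'a set" where
  "jacobson_radical R = {x \<in> carrier R. \<forall>M. maximalideal M R \<longrightarrow> x \<in> M}"

text \<open>
  As usual in the digraph library, a simple graph is a loop-free symmetric digraph:
  the edge between x and y is represented by the two arcs (x, y) and (y, x).
\<close>

definition jacobson_graph :: "('a, 'm) ring_scheme \<Rightarrow> 'a pair_pre_digraph" where
  "jacobson_graph R =
    \<lparr> pverts = carrier R - jacobson_radical R,
      parcs = {(x, y). x \<in> carrier R - jacobson_radical R \<and> y \<in> carrier R - jacobson_radical R
                 \<and> x \<noteq> y \<and> \<one>\<^bsub>R\<^esub> \<ominus>\<^bsub>R\<^esub> (x \<otimes>\<^bsub>R\<^esub> y) \<notin> Units R} \<rparr>"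

lemma pair_graph_jacobson_graph:
  assumes "cring R" and "finite (carrier R)"
  shows "pair_graph (jacobson_graph R)"
proof -
  interpret cring R by fact
  let ?V = "carrier R - jacobson_radical R"
  have "parcs (jacobson_graph R) \<subseteq> ?V \<times> ?V"
    by (auto simp: jacobson_graph_def)
  then have fin: "finite (parcs (jacobson_graph R))"
    by (rule finite_subset) (simp add: assms(2))
  have "sym (parcs (jacobson_graph R))"
    by (rule symI) (auto simp: jacobson_graph_def m_comm)
  then show ?thesis
    using assms(2) fin
    by unfold_locales (auto simp: jacobson_graph_def symmetric_def)
qed

definition undirected_edge :: "'a \<times> 'a \<Rightarrow> 'a set" where
  "undirected_edge e = {fst e, snd e}"

text \<open>
  A closed walk in a simple graph that traverses each undirected edge, in one of its two
  directions, exactly once. The library's \<open>euler_trail\<close> is the directed notion: on a symmetric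
  digraph it would use every edge once in each direction. The empty list of arcs is the trivial
  closed walk at u.
\<close>

definition eulerian_tour :: "'a pair_pre_digraph \<Rightarrow> 'a \<Rightarrow> ('a \<times> 'a) awalk \<Rightarrow> bool" where
  "eulerian_tour G u p \<longleftrightarrow>
    pre_digraph.awalk (with_proj G) u p u \<and>
    distinct (map undirected_edge p) \<and>
    undirected_edge ` set p = undirected_edge ` parcs G"

definition eulerian :: "'a pair_pre_digraph \<Rightarrow> bool" where
  "eulerian G \<longleftrightarrow> Digraph_Component.connected (with_proj G) \<and> (\<exists>u p. eulerian_tour G u p)"

end

theory Submission
  imports Defs
begin

text \<open>
  A connected graph is Eulerian iff all degrees are even. By the Chinese remainder theorem there is, for
  each maximal ideal \<open>M\<close> and each \<open>a \<notin> M\<close>, an \<open>x \<equiv> a\<close> modulo \<open>M\<close> lying in all other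
  maximal ideals; its degree is \<open>|M|\<close>, or \<open>|M| - 1\<close> if \<open>a\<^sup>2 \<equiv> 1\<close>. Taking \<open>a = 1\<close> makes \<open>|M|\<close> odd, and
  then every \<open>a\<close> is \<open>0\<close> or \<open>\<plusminus>1\<close> modulo \<open>M\<close>, so the residue fields have order 2 or 3. If \<open>|R|\<close> is even
  they all have order 2, whence the odd multiple \<open>|M| \<cdot> 1\<close> is a unit annihilating \<open>M\<close>, and \<open>M = 0\<close>. If
  \<open>|R|\<close> is odd they all have order 3, and if \<open>M\<close> were the only maximal ideal there would be no edges
  between the cosets \<open>1 + M\<close> and \<open>-1 + M\<close>. Conversely \<open>x\<^sup>3 \<equiv> x\<close> modulo the Jacobson radical, and
  \<open>y \<mapsto> 2 x - y\<close> pairs off the \<open>y\<close> for which \<open>1 - x y\<close> is a unit.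
\<close>

subsection \<open>Eulerian tours\<close>

context pair_graph
begin

text \<open>Every passage through \<open>w\<close> uses one arc in and one arc out, so only the two
  ends of the walk can disturb the parity. There are no loops, so an arc at \<open>w\<close> has
  exactly one end there.\<close>

lemma even_length_filter_undirected_edge:
  assumes "pcas u p v" and "set p \<subseteq> parcs G"
  shows "even (length (filter (\<lambda>e. w \<in> undirected_edge e) p)) \<longleftrightarrow> (u = w \<longleftrightarrow> v = w)"
  using assms
proof (induction p arbitrary: u)
  case Nil
  then show ?case by simp
next
  case (Cons e p)
  then have "fst e \<noteq> snd e" using pair_no_loops by auto
  with Cons.IH[of "snd e"] Cons.prems show ?case by (auto simp: undirected_edge_def)
qed

lemma incident_undirected_edgeE:
  assumes "e \<in> undirected_edge ` parcs G" and "w \<in> e"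
  obtains y where "(w, y) \<in> parcs G" and "e = undirected_edge (w, y)"
proof -
  obtain a b where ab: "(a, b) \<in> parcs G" "e = {a, b}" "w = a \<or> w = b"
    using assms by (auto simp: undirected_edge_def)
  moreover from ab have "(b, a) \<in> parcs G"
    using pair_sym_arcs by (auto simp: symmetric_def dest: symD)
  ultimately show thesis
    using that by (auto simp: undirected_edge_def)
qed

text \<open>Forgetting directions is injective on arcs with a common tail, and symmetry turns each
  edge at \<open>w\<close> into an arc leaving \<open>w\<close>. This ties the library's degree to
  the undirected edges that a tour counts.\<close>

lemma out_degree_eq_card_undirected_edge:
  "out_degree G w = card {e \<in> undirected_edge ` parcs G. w \<in> e}"
proof -
  have "bij_betw undirected_edge (out_arcs G w) {e \<in> undirected_edge ` parcs G. w \<in> e}"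
    unfolding bij_betw_def
  proof
    show "inj_on undirected_edge (out_arcs G w)"
      by (auto simp: inj_on_def undirected_edge_def doubleton_eq_iff)
    show "undirected_edge ` out_arcs G w = {e \<in> undirected_edge ` parcs G. w \<in> e}"
    proof (intro equalityI subsetI)
      fix e assume "e \<in> {e \<in> undirected_edge ` parcs G. w \<in> e}"
      then obtain y where "(w, y) \<in> parcs G" "e = undirected_edge (w, y)"
        using incident_undirected_edgeE[of e w] by blast
      then show "e \<in> undirected_edge ` out_arcs G w"
        by (auto simp: out_arcs_def)
    qed (auto simp: undirected_edge_def out_arcs_def)
  qed
  then show ?thesis
    unfolding out_degree_def by (rule bij_betw_same_card)
qed

lemma card_undirected_edge_eq_length_filter:
  assumes "distinct (map undirected_edge p)"
  shows "card {e \<in> undirected_edge ` set p. w \<in> e} =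
    length (filter (\<lambda>e. w \<in> undirected_edge e) p)"
proof -
  have "{e \<in> undirected_edge ` set p. w \<in> e} = set (filter (\<lambda>e. w \<in> e) (map undirected_edge p))"
    by auto
  also have "card \<dots> = length (filter (\<lambda>e. w \<in> e) (map undirected_edge p))"
    using assms by (intro distinct_card distinct_filter)
  finally show ?thesis by (simp add: filter_map comp_def)
qed

lemma eulerian_tour_imp_even_out_degree:
  assumes "eulerian_tour G u p"
  shows "even (out_degree G w)"
proof -
  have "out_degree G w = length (filter (\<lambda>e. w \<in> undirected_edge e) p)"
    using assms card_undirected_edge_eq_length_filter[of p w]
    by (simp add: out_degree_eq_card_undirected_edge eulerian_tour_def)
  then show ?thesis
    using assms even_length_filter_undirected_edge[of u p u w]
    by (auto simp: eulerian_tour_def awalk_def)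
qed

text \<open>A longest trail ends where all edges are used up, so by parity it is closed; rotating it shows
  that all edges at each of its vertices are used up.\<close>

lemma even_out_degree_imp_eulerian_tour:
  assumes conn: "connected G" and deg: "\<And>w. w \<in> pverts G \<Longrightarrow> even (out_degree G w)"
  shows "\<exists>u p. eulerian_tour G u p"
proof -
  define T where "T = (\<lambda>u p v. awalk u p v \<and> distinct (map undirected_edge p))"
  have sc: "strongly_connected G"
    using conn pair_sym_arcs by (intro symmetric_connected_imp_strongly_connected)
  then obtain u0 where "u0 \<in> pverts G" by (auto simp: strongly_connected_def)
  then have T0: "T u0 [] u0" by (simp add: T_def awalk_Nil_iff)
  have bound: "length p \<le> card (parcs G)" if "T u p v" for u p v
  proof -
    have "length p = card (set p)"
      using that by (auto simp: T_def distinct_map distinct_card)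
    also have "\<dots> \<le> card (parcs G)"
      using that pair_finite_arcs by (intro card_mono) (auto simp: T_def awalk_def)
    finally show ?thesis .
  qed
  have "\<exists>k. (\<exists>u p v. T u p v \<and> length p = k) \<and> (\<forall>l. (\<exists>u p v. T u p v \<and> length p = l) \<longrightarrow> l \<le> k)"
    using T0 bound by (intro Nat.ex_has_greatest_nat[where k = 0 and b = "card (parcs G)", simplified]) auto
  then obtain u p v where T: "T u p v" and max: "\<And>u' q v'. T u' q v' \<Longrightarrow> length q \<le> length p"
    by blast
  have saturated: "undirected_edge (z, y) \<in> undirected_edge ` set q"
    if q: "T x q z" "length q = length p" and "(z, y) \<in> parcs G" for x q y z
  proof (rule ccontr)
    assume "undirected_edge (z, y) \<notin> undirected_edge ` set q"
    moreover have "awalk x (q @ [(z, y)]) y"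
      using that by (intro awalk_appendI[of x q z]) (auto simp: T_def awalk_simps in_arcsD2)
    ultimately have "T x (q @ [(z, y)]) y"
      using q by (auto simp: T_def)
    from max[OF this] q show False by simp
  qed
  have "{e \<in> undirected_edge ` parcs G. v \<in> e} = {e \<in> undirected_edge ` set p. v \<in> e}"
  proof (intro equalityI subsetI)
    fix e assume e: "e \<in> {e \<in> undirected_edge ` parcs G. v \<in> e}"
    then obtain y where "(v, y) \<in> parcs G" "e = undirected_edge (v, y)"
      using incident_undirected_edgeE[of e v] by blast
    with e saturated[OF T refl] show "e \<in> {e \<in> undirected_edge ` set p. v \<in> e}"
      by auto
  qed (use T in \<open>auto simp: T_def awalk_def\<close>)
  then have "out_degree G v = length (filter (\<lambda>e. v \<in> undirected_edge e) p)"
    using T card_undirected_edge_eq_length_filter[of p v]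
    by (simp add: out_degree_eq_card_undirected_edge T_def)
  moreover have "v \<in> pverts G" using T by (auto simp: T_def)
  \<comment> \<open>The trail uses all edges at its end \<open>v\<close>, an even number, which an
    open trail cannot do.\<close>
  ultimately have uv: "u = v"
    using deg[of v] T even_length_filter_undirected_edge[of u p v v] by (auto simp: T_def awalk_def)
  \<comment> \<open>Rotating the closed trail makes any of its vertices the endpoint without
    changing the length.\<close>
  have all: "undirected_edge (w, y) \<in> undirected_edge ` set p"
    if w: "w \<in> set (pawalk_verts u p)" and wy: "(w, y) \<in> parcs G" for w y
  proof -
    have "awalk u p u" using T uv by (simp add: T_def)
    then obtain q r where qr: "p = q @ r" "awalk w (r @ q) w"
      using rotate_awalkE[OF _ w] by blast
    with T have "T w (r @ q) w" by (auto simp: T_def)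
    from saturated[OF this _ wy] qr show ?thesis by auto
  qed
  have adjacent: "y \<in> set (pawalk_verts u p)"
    if w: "w \<in> set (pawalk_verts u p)" and wy: "(w, y) \<in> parcs G" for w y
  proof -
    obtain e where "e \<in> set p" "y \<in> undirected_edge e"
      using all[OF w wy] by (auto simp: undirected_edge_def)
    then show ?thesis
      using T set_awalk_verts[of u p v] by (auto simp: T_def undirected_edge_def)
  qed
  \<comment> \<open>The vertices of the trail are closed under adjacency, so by connectedness they
    are all vertices.\<close>
  have visited: "w \<in> set (pawalk_verts u p)" if "w \<in> pverts G" for w
  proof -
    have "u \<in> pverts G" using T by (auto simp: T_def)
    with sc that have "u \<rightarrow>\<^sup>*\<^bsub>G\<^esub> w" by (auto simp: strongly_connected_def)
    then show ?thesis
    proof (induction rule: reachable_induct)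
      case base
      then show ?case using T hd_in_awalk_verts(1) by (auto simp: T_def)
    next
      case (step x y)
      then show ?case using adjacent by blast
    qed
  qed
  have "undirected_edge ` parcs G \<subseteq> undirected_edge ` set p"
    using all visited in_arcsD1 by auto
  moreover have "set p \<subseteq> parcs G" using T by (auto simp: T_def)
  ultimately have "eulerian_tour G u p"
    using T uv by (auto simp: T_def eulerian_tour_def)
  then show ?thesis by blast
qed

theorem eulerian_iff_even_out_degree:
  "eulerian G \<longleftrightarrow> connected G \<and> (\<forall>w \<in> pverts G. even (out_degree G w))"
  using eulerian_tour_imp_even_out_degree even_out_degree_imp_eulerian_tour
  unfolding eulerian_def by blast

end

subsection \<open>Products of residue rings of the integers\<close>

lemma (in ring) add_pow_one_ring_hom: "(\<lambda>k::int. add_pow R k \<one>) \<in> ring_hom \<Z> R"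
proof (rule ring_hom_memI)
  show "add_pow R (x \<otimes>\<^bsub>\<Z>\<^esub> y) \<one> = (add_pow R x \<one>) \<otimes> (add_pow R y \<one>)" for x y :: int
    by (simp add: add_pow_ldistr_int add.int_pow_pow mult.commute)
qed (simp_all add: add.int_pow_mult)

text \<open>The additive order of 1 divides the prime order of the ring and is not 1, so it is
  \<open>p\<close>. Hence the canonical map from the integers has kernel \<open>(p)\<close>, and the
  first isomorphism theorem applies once it is onto.\<close>

lemma (in ring) card_prime_imp_iso_ZFact:
  assumes "Factorial_Ring.prime (card (carrier R))"
  shows "R \<simeq> ZFact (int (card (carrier R)))"
proof -
  define p where "p = card (carrier R)"
  define h where "h = (\<lambda>k::int. add_pow R k \<one>)"
  have p: "Factorial_Ring.prime p" using assms by (simp add: p_def)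
  have fin: "finite (carrier R)"
    using p by (auto simp: p_def intro: card_ge_0_finite prime_gt_0_nat)
  interpret h: ring_hom_ring \<Z> R h
    using add_pow_one_ring_hom
    by (auto intro!: ring_hom_ringI2 int.ring_axioms ring_axioms simp: h_def)
  have "\<one> \<noteq> \<zero>"
  proof
    assume "\<one> = \<zero>"
    then have "carrier R = {\<zero>}" by (simp add: carrier_one_zero)
    then have "p = 1" by (simp add: p_def)
    with p show False by simp
  qed
  moreover have "add.ord \<one> dvd p"
    using add.ord_dvd_group_order[of \<one>] by (simp add: order_def p_def)
  ultimately have ord: "add.ord \<one> = p"
    using p add.ord_eq_1[of \<one>] by (auto simp: prime_nat_iff)
  have h_eq_0: "h k = \<zero> \<longleftrightarrow> int p dvd k" for k
    by (simp only: h_def add.int_pow_eq_id[OF one_closed] ord)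
  have ker: "a_kernel \<Z> R h = Idl\<^bsub>\<Z>\<^esub> {int p}"
  proof -
    have "a_kernel \<Z> R h = {k. int p dvd k}"
      by (simp only: a_kernel_def' h_eq_0 int_carrier_eq UNIV_I simp_thms)
    also have "\<dots> = {x * int p |x. True}"
      by (simp only: dvd_def mult.commute[of "int p"] simp_thms)
    finally show ?thesis by (simp only: int_Idl)
  qed
  have "inj_on h {0..<int p}"
  proof (rule inj_onI)
    fix a b assume ab: "a \<in> {0..<int p}" "b \<in> {0..<int p}" "h a = h b"
    have "h (a - b) = h a \<ominus> h b"
      using add.int_pow_diff[of \<one> a b] by (simp add: h_def a_minus_def)
    also have "\<dots> = \<zero>" using ab(3) by (simp add: a_minus_def r_neg)
    finally have "int p dvd a - b" by (simp only: h_eq_0)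
    then show "a = b"
      using ab by (metis atLeastLessThan_iff mod_eq_dvd_iff mod_pos_pos_trivial)
  qed
  \<comment> \<open>An injective image of \<open>p\<close> elements fills a ring of order
    \<open>p\<close>, so \<open>h\<close> is onto.\<close>
  then have "card (h ` {0..<int p}) = card (carrier R)"
    by (simp add: card_image p_def)
  then have "h ` {0..<int p} = carrier R"
    using fin by (intro card_subset_eq) (auto simp: h_def)
  then have "h ` carrier \<Z> = carrier R"
    by (auto simp: h_def)
  then have "ZFact (int p) \<simeq> R"
    using h.FactRing_iso ker by (simp add: ZFact_def)
  then show ?thesis
    using ring_iso_sym[OF cring.axioms(1)[OF ZFact_is_cring]] by (simp add: p_def)
qed

lemma carrier_ZFact: "carrier (ZFact k) = ZMod k ` UNIV"
  by (auto simp: ZFact_defs A_RCOSETS_def' ZMod_def)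

lemma card_ZFact:
  assumes "k > 0"
  shows "card (carrier (ZFact k)) = nat k"
proof -
  have "carrier (ZFact k) = ZMod k ` {0..<k}"
    unfolding carrier_ZFact
  proof (intro equalityI subsetI)
    fix a assume "a \<in> range (ZMod k)"
    then obtain r where "a = ZMod k r" by blast
    then have "a = ZMod k (r mod k)" by (simp flip: ZMod_mod)
    then show "a \<in> ZMod k ` {0..<k}" using assms by simp
  qed auto
  moreover have "inj_on (ZMod k) {0..<k}"
    by (auto simp: inj_on_def ZMod_eq_mod)
  ultimately show ?thesis
    by (simp add: card_image)
qed

text \<open>Fermat's little theorem for the prime 3, checked on the three residues. The converse
  direction extracts this and the cardinality from the factors \<open>ZFact 3\<close>.\<close>

lemma ZFact_3_cube:
  assumes "a \<in> carrier (ZFact 3)"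
  shows "a \<otimes>\<^bsub>ZFact 3\<^esub> (a \<otimes>\<^bsub>ZFact 3\<^esub> a) = a"
proof -
  obtain r where r: "a = ZMod 3 r"
    using assms by (auto simp: carrier_ZFact)
  interpret I: ideal "Idl\<^bsub>\<Z>\<^esub> {3}" \<Z>
    by (rule int.genideal_ideal) simp
  have mult: "ZMod 3 x \<otimes>\<^bsub>ZFact 3\<^esub> ZMod 3 y = ZMod 3 (x * y)" for x y
    using ring_hom_mult[OF I.rcos_ring_hom, of x y] by (simp add: ZMod_def ZFact_def)
  have "r mod 3 = 0 \<or> r mod 3 = 1 \<or> r mod 3 = 2" by presburger
  then have "(r * (r * r)) mod 3 = r mod 3"
    using mod_mult_eq[of r 3 r] mod_mult_eq[of r 3 "r * r"] by auto
  then show ?thesis by (simp add: r mult ZMod_eq_mod)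
qed

text \<open>Lets the residue fields in a product of quotients be exchanged for copies of
  \<open>ZFact 3\<close>. The induction goes through the binary product of head and tail.\<close>

lemma RDirProd_list_cong:
  assumes "list_all2 (\<simeq>) Rs Ss"
  shows "RDirProd_list Rs \<simeq> RDirProd_list Ss"
  using assms
proof (induction rule: list_all2_induct)
  case Nil
  have "(\<lambda>_. []) \<in> ring_iso nil_ring nil_ring"
    by (auto intro!: ring_iso_memI simp: bij_betw_def monoid.defs)
  then show ?case
    by (auto simp: is_ring_iso_def)
next
  case (Cons R Rs S Ss)
  obtain f where f: "f \<in> ring_iso R S"
    using Cons by (auto simp: is_ring_iso_def)
  obtain g where g: "g \<in> ring_iso (RDirProd_list Rs) (RDirProd_list Ss)"
    using Cons by (auto simp: is_ring_iso_def)
  show ?case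
    using ring_iso_set_trans[OF ring_iso_set_trans[OF RDirProd_list_iso2 RDirProd_iso6[OF f g]]
      RDirProd_list_iso1[of S Ss]]
    by (auto simp: is_ring_iso_def)
qed

lemma card_RDirProd_list_replicate:
  "card (carrier (RDirProd_list (replicate n R))) = card (carrier R) ^ n"
proof (induction n)
  case (Suc n)
  have "inj_on (\<lambda>(x, xs). x # xs) A" for A :: "('a \<times> 'a list) set"
    by (auto simp: inj_on_def)
  then show ?case
    by (simp add: RDirProd_list_carrier card_image card_cartesian_product Suc)
qed simp

lemma RDirProd_list_replicate_cube:
  assumes "ring R" and "\<And>a. a \<in> carrier R \<Longrightarrow> a \<otimes>\<^bsub>R\<^esub> (a \<otimes>\<^bsub>R\<^esub> a) = a"
    and "as \<in> carrier (RDirProd_list (replicate n R))"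
  shows "as \<otimes>\<^bsub>RDirProd_list (replicate n R)\<^esub> (as \<otimes>\<^bsub>RDirProd_list (replicate n R)\<^esub> as) = as"
  using assms(3)
proof (induction n arbitrary: as)
  case 0
  then show ?case by (simp add: monoid.defs)
next
  case (Suc n)
  let ?S = "RDirProd_list (replicate n R)" and ?T = "RDirProd_list (R # replicate n R)"
  interpret R: ring R by (rule assms(1))
  interpret S: ring ?S using assms(1) by (intro RDirProd_list_is_ring) simp
  have mult: "(x # xs) \<otimes>\<^bsub>?T\<^esub> (y # ys) = (x \<otimes>\<^bsub>R\<^esub> y) # (xs \<otimes>\<^bsub>?S\<^esub> ys)"
    if "x \<in> carrier R" "y \<in> carrier R" "xs \<in> carrier ?S" "ys \<in> carrier ?S" for x y xs ys
    using ring_iso_memE(2)[OF RDirProd_list_iso1[of R "replicate n R"], of "(x, xs)" "(y, ys)"] that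
    by (simp add: RDirProd_carrier) (simp add: RDirProd_def DirProd_def monoid.defs)
  obtain x xs where as: "as = x # xs" "x \<in> carrier R" "xs \<in> carrier ?S"
    using Suc.prems by (auto simp: RDirProd_list_carrier)
  show ?case
    using as assms(2)[of x] Suc.IH[of xs] by (simp add: mult R.m_closed S.m_closed)
qed

lemma ring_iso_cube:
  assumes iso: "R \<simeq> S" and "ring R"
    and cube: "\<And>a. a \<in> carrier S \<Longrightarrow> a \<otimes>\<^bsub>S\<^esub> (a \<otimes>\<^bsub>S\<^esub> a) = a"
    and a: "a \<in> carrier R"
  shows "a \<otimes>\<^bsub>R\<^esub> (a \<otimes>\<^bsub>R\<^esub> a) = a"
proof -
  interpret ring R by fact
  obtain h where "h \<in> ring_iso R S" using iso by (auto simp: is_ring_iso_def)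
  note h = ring_iso_memE[OF this]
  have "h (a \<otimes>\<^bsub>R\<^esub> (a \<otimes>\<^bsub>R\<^esub> a)) = h a"
    using a by (simp add: h(2) cube h(1))
  then show ?thesis
    using a bij_betw_imp_inj_on[OF h(5)] by (simp add: inj_on_eq_iff)
qed

lemma ring_iso_imp_card_eq:
  assumes "R \<simeq> S"
  shows "card (carrier R) = card (carrier S)"
  using assms by (auto simp: is_ring_iso_def ring_iso_def intro: bij_betw_same_card)

subsection \<open>Maximal ideals of finite rings\<close>

text \<open>Finiteness stands in for Zorn's lemma: a finite family of proper ideals has a maximal
  member above \<open>I\<close>.\<close>

lemma (in ring) exists_maximalideal_superset:
  assumes "finite (carrier R)" and "ideal I R" and "I \<noteq> carrier R"
  shows "\<exists>M. maximalideal M R \<and> I \<subseteq> M"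
proof -
  define S where "S = {K. ideal K R \<and> K \<noteq> carrier R}"
  have sub: "K \<subseteq> carrier R" if "ideal K R" for K
    using ideal.Icarr[OF that] by blast
  have "S \<subseteq> Pow (carrier R)" using sub by (auto simp: S_def)
  then have "finite S" using assms(1) by (simp add: finite_subset)
  moreover have "I \<in> S" using assms by (simp add: S_def)
  ultimately obtain M where M: "M \<in> S" "I \<subseteq> M" "\<And>K. K \<in> S \<Longrightarrow> M \<subseteq> K \<Longrightarrow> M = K"
    using finite_has_maximal2[of S I] by blast
  then have "maximalideal M R"
    by (intro maximalidealI) (auto simp: S_def)
  with M show ?thesis by blast
qed

lemma (in ring) maximalideal_one_notin:
  assumes "maximalideal M R"
  shows "\<one> \<notin> M"
proof -
  interpret M: maximalideal M R by fact
  show ?thesis using M.one_imp_carrier M.I_notcarr by blast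
qed

lemma (in ring) maximalideal_subset_imp_eq:
  assumes "maximalideal M R" and "maximalideal N R" and "M \<subseteq> N"
  shows "M = N"
  using assms maximalideal.I_maximal[of M R N] maximalideal.I_notcarr[of N R]
    maximalideal.axioms(1)[of N R] ideal.Icarr[of N R] by blast

context cring
begin

lemma maximalideal_mult_mem_iff:
  assumes "maximalideal M R" and "a \<in> carrier R" and "b \<in> carrier R"
  shows "a \<otimes> b \<in> M \<longleftrightarrow> a \<in> M \<or> b \<in> M"
proof -
  interpret M: primeideal M R using assms(1) by (rule maximalideal_prime)
  show ?thesis using assms(2,3) M.I_prime M.I_l_closed M.I_r_closed by metis
qed

text \<open>By maximality \<open>M\<close> and \<open>x\<close> together generate the whole ring, in
  particular 1. This is the field property of the residue ring, phrased with elements.\<close>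

lemma maximalideal_exists_inverse_mod:
  assumes "maximalideal M R" and x: "x \<in> carrier R" "x \<notin> M"
  shows "\<exists>r\<in>carrier R. \<one> \<ominus> x \<otimes> r \<in> M"
proof -
  interpret M: maximalideal M R by fact
  have ideal: "ideal (M <+> PIdl x) R"
    using M.ideal_axioms cgenideal_ideal x by (intro add_ideals)
  have "M \<subseteq> M <+> PIdl x"
  proof
    fix m assume "m \<in> M"
    then have "m = m \<oplus> \<zero> \<otimes> x" using x M.Icarr by simp
    with \<open>m \<in> M\<close> show "m \<in> M <+> PIdl x"
      unfolding set_add_def' cgenideal_def by blast
  qed
  moreover have "x = \<zero> \<oplus> \<one> \<otimes> x" using x by simp
  then have "x \<in> M <+> PIdl x"
    unfolding set_add_def' cgenideal_def using M.zero_closed by blast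
  ultimately have "M <+> PIdl x = carrier R"
    using M.I_maximal[OF ideal] ideal.Icarr[OF ideal] x by blast
  then have "\<one> \<in> M <+> PIdl x" by simp
  then obtain m r where mr: "m \<in> M" "r \<in> carrier R" "\<one> = m \<oplus> r \<otimes> x"
    unfolding set_add_def' cgenideal_def by blast
  have "m \<in> carrier R" using mr(1) by (rule M.Icarr)
  have "\<one> \<ominus> x \<otimes> r = (m \<oplus> r \<otimes> x) \<ominus> x \<otimes> r"
    by (rule arg_cong[OF mr(3)])
  also have "\<dots> = m" using x(1) mr(2) \<open>m \<in> carrier R\<close> by algebra
  finally show ?thesis using mr(1,2) by auto
qed

end

section \<open>Nonunits and neighbourhoods in finite rings\<close>

locale finite_nonzero_cring = cring R for R (structure) +
  assumes finite_carrier: "finite (carrier R)" and one_neq_zero: "\<one> \<noteq> \<zero>"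
begin

text \<open>A nonunit generates a proper principal ideal, which lies in a maximal ideal. Adjacency
  of distinct vertices \<open>x\<close> and \<open>y\<close> thereby becomes
  \<open>x y \<equiv> 1\<close> modulo some maximal ideal.\<close>

lemma nonunit_iff:
  assumes x: "x \<in> carrier R"
  shows "x \<notin> Units R \<longleftrightarrow> (\<exists>M. maximalideal M R \<and> x \<in> M)"
proof
  assume nonunit: "x \<notin> Units R"
  have "\<one> \<notin> PIdl x"
  proof
    assume "\<one> \<in> PIdl x"
    then obtain y where "y \<in> carrier R" "\<one> = y \<otimes> x" by (auto simp: cgenideal_def)
    then have "x \<in> Units R" using x m_comm[of x] unfolding Units_def by auto
    with nonunit show False ..
  qed
  then have "PIdl x \<noteq> carrier R" by auto
  then show "\<exists>M. maximalideal M R \<and> x \<in> M"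
    using exists_maximalideal_superset[OF finite_carrier cgenideal_ideal[OF x]] cgenideal_self[OF x]
    by blast
next
  assume "\<exists>M. maximalideal M R \<and> x \<in> M"
  then obtain M where M: "maximalideal M R" "x \<in> M" by blast
  interpret M: maximalideal M R by fact
  show "x \<notin> Units R"
  proof
    assume "x \<in> Units R"
    then have "\<one> \<in> M" using M.I_l_closed[OF M(2), of "inv x"] by simp
    with M(1) show False using maximalideal_one_notin by blast
  qed
qed

lemma finite_maximalideals: "finite {M. maximalideal M R}"
proof (rule finite_subset)
  show "{M. maximalideal M R} \<subseteq> Pow (carrier R)"
  proof (intro subsetI PowI)
    fix M x assume "M \<in> {M. maximalideal M R}" "x \<in> M"
    then show "x \<in> carrier R" using ideal.Icarr maximalideal.axioms(1) by fastforce
  qed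
qed (simp add: finite_carrier)

lemma exists_maximalideal: "\<exists>M. maximalideal M R"
  using exists_maximalideal_superset[OF finite_carrier zeroideal] one_neq_zero one_closed by blast

text \<open>Existence of a maximal ideal matters here, because the intersection of the empty family
  would be the whole type.\<close>

lemma jacobson_radical_eq_Inter: "jacobson_radical R = \<Inter> {M. maximalideal M R}"
proof -
  obtain M where "maximalideal M R" using exists_maximalideal by blast
  then show ?thesis
    using ideal.Icarr[OF maximalideal.axioms(1)[of M R]] by (auto simp: jacobson_radical_def)
qed

lemma ideal_jacobson_radical: "ideal (jacobson_radical R) R"
  unfolding jacobson_radical_eq_Inter
  using exists_maximalideal maximalideal.axioms(1) by (intro i_Intersect) auto

lemma one_minus_mult_mem_maximalidealD:
  assumes M: "maximalideal M R" and xy: "x \<in> carrier R" "y \<in> carrier R"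
    and mem: "\<one> \<ominus> x \<otimes> y \<in> M"
  shows "x \<notin> M" and "y \<notin> M"
proof -
  interpret M: maximalideal M R by fact
  have "x \<otimes> y \<notin> M"
  proof
    assume "x \<otimes> y \<in> M"
    with mem have "(\<one> \<ominus> x \<otimes> y) \<oplus> x \<otimes> y \<in> M" by simp
    moreover have "(\<one> \<ominus> x \<otimes> y) \<oplus> x \<otimes> y = \<one>" using xy by algebra
    ultimately show False using maximalideal_one_notin[OF M] by simp
  qed
  then show "x \<notin> M" and "y \<notin> M"
    using maximalideal_mult_mem_iff[OF M xy] by auto
qed

text \<open>The Chinese remainder theorem in elementary form: an element \<open>e\<close> lying in
  all other maximal ideals but not in \<open>M\<close> is normalized to 1 modulo \<open>M\<close> by
  an inverse \<open>r\<close> and then multiplied by \<open>a\<close>.\<close>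

lemma exists_separating_element:
  assumes M: "maximalideal M R" and a: "a \<in> carrier R"
  shows "\<exists>x\<in>carrier R. x \<ominus> a \<in> M \<and> (\<forall>N. maximalideal N R \<longrightarrow> N \<noteq> M \<longrightarrow> x \<in> N)"
proof -
  interpret M: maximalideal M R by fact
  \<comment> \<open>Induction over the other maximal ideals: each contributes a factor in
    \<open>N\<close> but not in \<open>M\<close>, and primality keeps the product outside
    \<open>M\<close>.\<close>
  have "\<exists>e\<in>carrier R. e \<notin> M \<and> (\<forall>N\<in>\<N>. e \<in> N)"
    if "finite \<N>" and "\<N> \<subseteq> {N. maximalideal N R \<and> N \<noteq> M}" for \<N>
    using that
  proof (induction \<N> rule: finite_induct)
    case empty
    then show ?case using maximalideal_one_notin[OF M] by auto
  next
    case (insert N \<N>)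
    then obtain e where e: "e \<in> carrier R" "e \<notin> M" "\<forall>N\<in>\<N>. e \<in> N" by auto
    have N: "maximalideal N R" "N \<noteq> M" using insert by auto
    then obtain d where d: "d \<in> N" "d \<notin> M"
      using maximalideal_subset_imp_eq[OF N(1) M] by blast
    interpret N: maximalideal N R by (rule N(1))
    have dc: "d \<in> carrier R" using d(1) by (rule N.Icarr)
    have "d \<otimes> e \<in> K" if "K \<in> insert N \<N>" for K
      using that insert.prems d e dc maximalideal_mult_mem_iff[of K d e] by auto
    moreover have "d \<otimes> e \<notin> M"
      using maximalideal_mult_mem_iff[OF M dc e(1)] d e by blast
    ultimately show ?case using e dc by blast
  qed
  from this[of "{N. maximalideal N R \<and> N \<noteq> M}"]
  obtain e where e: "e \<in> carrier R" "e \<notin> M" "\<And>N. maximalideal N R \<Longrightarrow> N \<noteq> M \<Longrightarrow> e \<in> N"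
    using finite_subset[OF _ finite_maximalideals, of "{N. maximalideal N R \<and> N \<noteq> M}"] by auto
  obtain r where r: "r \<in> carrier R" "\<one> \<ominus> e \<otimes> r \<in> M"
    using maximalideal_exists_inverse_mod[OF M e(1,2)] by blast
  have "e \<otimes> r \<otimes> a \<ominus> a = \<ominus> ((\<one> \<ominus> e \<otimes> r) \<otimes> a)" using e(1) r(1) a by algebra
  then have "e \<otimes> r \<otimes> a \<ominus> a \<in> M" using r a M.I_r_closed by simp
  moreover have "e \<otimes> r \<otimes> a \<in> N" if "maximalideal N R" "N \<noteq> M" for N
    using e(1) e(3)[OF that] r(1) a by (simp add: maximalideal_mult_mem_iff[OF that(1)])
  ultimately show ?thesis using e r a by blast
qed

text \<open>If \<open>1 - x y\<close> is a nonunit then \<open>x y\<close> is 1 modulo some maximal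
  ideal, so \<open>y\<close> is a vertex automatically. Only \<open>x\<close> itself has to be
  removed, as the graph has no loops.\<close>

lemma out_degree_jacobson_graph:
  assumes x: "x \<in> carrier R - jacobson_radical R"
  shows "out_degree (with_proj (jacobson_graph R)) x =
    card ({y \<in> carrier R. \<one> \<ominus> x \<otimes> y \<notin> Units R} - {x})"
proof -
  have "y \<notin> jacobson_radical R" if y: "y \<in> carrier R" "\<one> \<ominus> x \<otimes> y \<notin> Units R" for y
  proof -
    obtain M where "maximalideal M R" "\<one> \<ominus> x \<otimes> y \<in> M"
      using nonunit_iff[of "\<one> \<ominus> x \<otimes> y"] x y by auto
    then show ?thesis
      using one_minus_mult_mem_maximalidealD(2)[of M x y] x y by (auto simp: jacobson_radical_def)
  qed
  then have "out_arcs (with_proj (jacobson_graph R)) x =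
      Pair x ` ({y \<in> carrier R. \<one> \<ominus> x \<otimes> y \<notin> Units R} - {x})"
    using x by (auto simp: out_arcs_def jacobson_graph_def)
  then show ?thesis
    by (simp add: out_degree_def card_image inj_on_def)
qed

text \<open>\<open>x\<close> vanishes modulo every maximal ideal other than \<open>M\<close>, so
  \<open>1 - x y\<close> is 1 there and only \<open>M\<close> can make it a nonunit.\<close>

lemma neighbourhood_separating_element:
  assumes M: "maximalideal M R" and x: "x \<in> carrier R"
    and other: "\<And>N. maximalideal N R \<Longrightarrow> N \<noteq> M \<Longrightarrow> x \<in> N"
  shows "{y \<in> carrier R. \<one> \<ominus> x \<otimes> y \<notin> Units R} = {y \<in> carrier R. \<one> \<ominus> x \<otimes> y \<in> M}"
proof (intro Collect_cong conj_cong refl)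
  fix y assume y: "y \<in> carrier R"
  have "N = M" if "maximalideal N R" "\<one> \<ominus> x \<otimes> y \<in> N" for N
    using one_minus_mult_mem_maximalidealD(1)[OF that(1) x y that(2)] other[OF that(1)] by blast
  then show "\<one> \<ominus> x \<otimes> y \<notin> Units R \<longleftrightarrow> \<one> \<ominus> x \<otimes> y \<in> M"
    using nonunit_iff[of "\<one> \<ominus> x \<otimes> y"] M x y by auto
qed

text \<open>The inverses of \<open>x\<close> modulo \<open>M\<close> form a single coset
  \<open>r + M\<close>.\<close>

lemma card_inverses_mod_maximalideal:
  assumes M: "maximalideal M R" and x: "x \<in> carrier R" "x \<notin> M"
  shows "card {y \<in> carrier R. \<one> \<ominus> x \<otimes> y \<in> M} = card M"
proof -
  interpret M: maximalideal M R by fact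
  obtain r where r: "r \<in> carrier R" "\<one> \<ominus> x \<otimes> r \<in> M"
    using maximalideal_exists_inverse_mod[OF M x] by blast
  have "bij_betw (\<lambda>m. r \<oplus> m) M {y \<in> carrier R. \<one> \<ominus> x \<otimes> y \<in> M}"
    unfolding bij_betw_def
  proof
    show "inj_on (\<lambda>m. r \<oplus> m) M"
      using r M.Icarr by (auto simp: inj_on_def)
    show "(\<lambda>m. r \<oplus> m) ` M = {y \<in> carrier R. \<one> \<ominus> x \<otimes> y \<in> M}"
    proof (intro equalityI subsetI)
      fix y assume "y \<in> (\<lambda>m. r \<oplus> m) ` M"
      then obtain m where m: "m \<in> M" "y = r \<oplus> m" by blast
      then have "\<one> \<ominus> x \<otimes> y = (\<one> \<ominus> x \<otimes> r) \<ominus> x \<otimes> m"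
        using x(1) r(1) M.Icarr[OF m(1)] by (simp only:) algebra
      then show "y \<in> {y \<in> carrier R. \<one> \<ominus> x \<otimes> y \<in> M}"
        using m r x M.Icarr M.I_l_closed by (simp add: a_minus_def)
    next
      fix y assume y: "y \<in> {y \<in> carrier R. \<one> \<ominus> x \<otimes> y \<in> M}"
      then have "x \<otimes> (y \<ominus> r) = (\<one> \<ominus> x \<otimes> r) \<ominus> (\<one> \<ominus> x \<otimes> y)"
        using x(1) r(1) by (simp only: mem_Collect_eq) algebra
      also have "\<dots> \<in> M" using y r by (simp add: a_minus_def)
      finally have "y \<ominus> r \<in> M"
        using maximalideal_mult_mem_iff[OF M x(1), of "y \<ominus> r"] x y r by simp
      moreover have "y = r \<oplus> (y \<ominus> r)" using y r(1) by (simp only: mem_Collect_eq) algebra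
      ultimately show "y \<in> (\<lambda>m. r \<oplus> m) ` M" by blast
    qed
  qed
  then show ?thesis by (rule bij_betw_same_card[symmetric])
qed

end

subsection \<open>Degrees in the Jacobson graph\<close>

text \<open>The orbits \<open>{x, f x}\<close> partition \<open>A\<close> into pairs.\<close>

lemma even_card_involution:
  assumes "finite A" and "\<And>x. x \<in> A \<Longrightarrow> f x \<in> A" and "\<And>x. x \<in> A \<Longrightarrow> f (f x) = x"
    and "\<And>x. x \<in> A \<Longrightarrow> f x \<noteq> x"
  shows "even (card A)"
proof -
  let ?C = "(\<lambda>x. {x, f x}) ` A"
  have Union: "\<Union>?C = A" using assms(2) by auto
  have "2 * card ?C = card (\<Union>?C)"
  proof (rule card_partition)
    show "finite (\<Union>?C)" using assms(1) Union by simp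
    show "card c = 2" if "c \<in> ?C" for c
    proof -
      from that obtain x where x: "x \<in> A" "c = {x, f x}" by blast
      then have "x \<noteq> f x" using assms(4)[OF x(1)] by simp
      with x show ?thesis by simp
    qed
    show "c \<inter> d = {}" if "c \<in> ?C" "d \<in> ?C" "c \<noteq> d" for c d
    proof -
      from that obtain x y where xy: "x \<in> A" "c = {x, f x}" "y \<in> A" "d = {y, f y}" by blast
      with \<open>c \<noteq> d\<close> have "x \<noteq> y" "x \<noteq> f y" "f x \<noteq> y"
        using assms(3)[OF xy(1)] assms(3)[OF xy(3)] by auto
      moreover have "f x \<noteq> f y"
        using \<open>x \<noteq> y\<close> assms(3)[OF xy(1)] assms(3)[OF xy(3)] by metis
      ultimately show ?thesis using xy by auto
    qed
  qed (simp add: assms(1))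
  then show ?thesis using Union by (metis dvd_triv_left)
qed

context finite_nonzero_cring
begin

lemma jacobson_graph_is_pair_graph: "pair_graph (jacobson_graph R)"
  using pair_graph_jacobson_graph[OF is_cring finite_carrier] .

lemma pverts_jacobson_graph: "pverts (jacobson_graph R) = carrier R - jacobson_radical R"
  by (simp add: jacobson_graph_def)

lemma card_carrier_Quot_mult:
  assumes "ideal I R"
  shows "card (carrier (R Quot I)) * card I = card (carrier R)"
  using a_lagrange[OF finite_carrier ideal.axioms(1)[OF assms]]
  by (simp add: FactRing_def order_def)

section \<open>Residue fields forced by even degrees\<close>

lemma separating_element_notin:
  assumes "maximalideal M R" and "x \<in> carrier R" "a \<in> carrier R" "x \<ominus> a \<in> M" "a \<notin> M"
  shows "x \<notin> M"
proof
  interpret M: maximalideal M R by fact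
  assume "x \<in> M"
  then have "x \<ominus> (x \<ominus> a) \<in> M" using assms(4) by (simp add: a_minus_def)
  moreover have "x \<ominus> (x \<ominus> a) = a" using assms(2,3) by algebra
  ultimately show False using assms(5) by simp
qed

text \<open>\<open>1 - x x\<close> factors as \<open>-(x - 1) (x + 1)\<close> and \<open>M\<close>
  is prime. This decides whether \<open>x\<close> is among its own inverses modulo \<open>M\<close>,
  hence whether the removal of \<open>x\<close> lowers the degree.\<close>

lemma one_minus_square_mem_iff:
  assumes M: "maximalideal M R" and x: "x \<in> carrier R"
  shows "\<one> \<ominus> x \<otimes> x \<in> M \<longleftrightarrow> x \<ominus> \<one> \<in> M \<or> x \<oplus> \<one> \<in> M"
proof -
  have "\<one> \<ominus> x \<otimes> x = (\<ominus> (x \<ominus> \<one>)) \<otimes> (x \<oplus> \<one>)" using x by algebra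
  also have "\<dots> \<in> M \<longleftrightarrow> \<ominus> (x \<ominus> \<one>) \<in> M \<or> x \<oplus> \<one> \<in> M"
    using x by (intro maximalideal_mult_mem_iff[OF M]) simp_all
  also have "\<ominus> (x \<ominus> \<one>) = (\<ominus> \<one>) \<otimes> (x \<ominus> \<one>)" using x by algebra
  also have "\<dots> \<in> M \<longleftrightarrow> x \<ominus> \<one> \<in> M"
    using x maximalideal_mult_mem_iff[OF M, of "\<ominus> \<one>" "x \<ominus> \<one>"] maximalideal_one_notin[OF M]
      additive_subgroup.a_inv_closed[OF ideal.axioms(1)[OF maximalideal.axioms(1)[OF M]], of "\<ominus> \<one>"]
    by auto
  finally show ?thesis .
qed

text \<open>An \<open>x\<close> that is 1 modulo \<open>M\<close> and 0 modulo the others belongs to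
  its own coset of inverses, so its degree is \<open>|M| - 1\<close>.\<close>

lemma odd_card_maximalideal:
  assumes even: "\<forall>x\<in>pverts (jacobson_graph R). even (out_degree (with_proj (jacobson_graph R)) x)"
    and M: "maximalideal M R"
  shows "odd (card M)"
proof -
  interpret M: maximalideal M R by fact
  obtain x where x: "x \<in> carrier R" "x \<ominus> \<one> \<in> M"
      "\<And>N. maximalideal N R \<Longrightarrow> N \<noteq> M \<Longrightarrow> x \<in> N"
    using exists_separating_element[OF M one_closed] by blast
  have xM: "x \<notin> M"
    using separating_element_notin[OF M x(1) one_closed x(2)] maximalideal_one_notin[OF M] by blast
  let ?N = "{y \<in> carrier R. \<one> \<ominus> x \<otimes> y \<in> M}"
  have "x \<in> ?N" using x one_minus_square_mem_iff[OF M x(1)] by simp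
  moreover have "out_degree (with_proj (jacobson_graph R)) x = card (?N - {x})"
    using x(1) xM M out_degree_jacobson_graph[of x] neighbourhood_separating_element[OF M x(1) x(3)]
    by (auto simp: jacobson_radical_def)
  moreover have "card ?N = card M" by (rule card_inverses_mod_maximalideal[OF M x(1) xM])
  \<comment> \<open>Natural subtraction truncates, so \<open>card ?N - 1\<close> reveals the parity
    only for positive \<open>card ?N\<close>.\<close>
  moreover have "card ?N > 0" using \<open>x \<in> ?N\<close> finite_carrier by (auto simp: card_gt_0_iff)
  ultimately show ?thesis
    using bspec[OF even, of x] x(1) xM M by (auto simp: pverts_jacobson_graph jacobson_radical_def)
qed

text \<open>Otherwise an \<open>x\<close> that is \<open>a\<close> modulo \<open>M\<close> and 0
  modulo the others is not its own inverse modulo \<open>M\<close>; nothing is removed from its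
  coset of inverses, and its degree is the odd number \<open>|M|\<close>.\<close>

lemma residue_field_elements:
  assumes even: "\<forall>x\<in>pverts (jacobson_graph R). even (out_degree (with_proj (jacobson_graph R)) x)"
    and M: "maximalideal M R" and a: "a \<in> carrier R" "a \<notin> M"
  shows "a \<ominus> \<one> \<in> M \<or> a \<oplus> \<one> \<in> M"
proof (rule ccontr)
  interpret M: maximalideal M R by fact
  assume neg: "\<not> ?thesis"
  obtain x where x: "x \<in> carrier R" "x \<ominus> a \<in> M"
      "\<And>N. maximalideal N R \<Longrightarrow> N \<noteq> M \<Longrightarrow> x \<in> N"
    using exists_separating_element[OF M a(1)] by blast
  have xM: "x \<notin> M"
    using separating_element_notin[OF M x(1) a(1) x(2) a(2)] .
  let ?N = "{y \<in> carrier R. \<one> \<ominus> x \<otimes> y \<in> M}"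
  have "x \<ominus> \<one> \<notin> M"
  proof (rule separating_element_notin[OF M])
    have "(x \<ominus> \<one>) \<ominus> (a \<ominus> \<one>) = x \<ominus> a" using x(1) a(1) by algebra
    then show "(x \<ominus> \<one>) \<ominus> (a \<ominus> \<one>) \<in> M" using x(2) by simp
  qed (use x a neg in simp_all)
  moreover have "x \<oplus> \<one> \<notin> M"
  proof (rule separating_element_notin[OF M])
    have "(x \<oplus> \<one>) \<ominus> (a \<oplus> \<one>) = x \<ominus> a" using x(1) a(1) by algebra
    then show "(x \<oplus> \<one>) \<ominus> (a \<oplus> \<one>) \<in> M" using x(2) by simp
  qed (use x a neg in simp_all)
  ultimately have "x \<notin> ?N" using x(1) one_minus_square_mem_iff[OF M x(1)] by simp
  moreover have "out_degree (with_proj (jacobson_graph R)) x = card (?N - {x})"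
    using x(1) xM M out_degree_jacobson_graph[of x] neighbourhood_separating_element[OF M x(1) x(3)]
    by (auto simp: jacobson_radical_def)
  moreover have "card ?N = card M" by (rule card_inverses_mod_maximalideal[OF M x(1) xM])
  ultimately show False
    using bspec[OF even, of x] odd_card_maximalideal[OF even M] x(1) xM M
    by (auto simp: pverts_jacobson_graph jacobson_radical_def)
qed

lemma carrier_Quot_maximalideal:
  assumes M: "maximalideal M R"
    and residue: "\<And>a. a \<in> carrier R \<Longrightarrow> a \<notin> M \<Longrightarrow> a \<ominus> \<one> \<in> M \<or> a \<oplus> \<one> \<in> M"
  shows "carrier (R Quot M) = {M +> \<zero>, M +> \<one>, M +> \<ominus> \<one>}"
proof -
  interpret M: maximalideal M R by fact
  have "M +> a \<in> {M +> \<zero>, M +> \<one>, M +> \<ominus> \<one>}" if a: "a \<in> carrier R" for a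
  proof -
    have "a \<ominus> \<zero> = a" "a \<ominus> \<ominus> \<one> = a \<oplus> \<one>" using a by algebra+
    with a residue[OF a] have "a \<ominus> \<zero> \<in> M \<or> a \<ominus> \<one> \<in> M \<or> a \<ominus> \<ominus> \<one> \<in> M" by auto
    then show ?thesis
      using a quotient_eq_iff_same_a_r_cos[OF M.ideal_axioms a] by auto
  qed
  moreover have "carrier (R Quot M) = (\<lambda>a. M +> a) ` carrier R"
    by (auto simp: FactRing_def A_RCOSETS_def')
  ultimately show ?thesis by auto
qed

lemma card_Quot_maximalideal:
  assumes M: "maximalideal M R"
    and residue: "\<And>a. a \<in> carrier R \<Longrightarrow> a \<notin> M \<Longrightarrow> a \<ominus> \<one> \<in> M \<or> a \<oplus> \<one> \<in> M"
  shows "card (carrier (R Quot M)) = (if \<one> \<oplus> \<one> \<in> M then 2 else 3)"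
proof -
  interpret M: maximalideal M R by fact
  note eq_iff = quotient_eq_iff_same_a_r_cos[OF M.ideal_axioms, symmetric]
  have one: "\<one> \<notin> M" by (rule maximalideal_one_notin[OF M])
  have "\<zero> \<ominus> \<one> \<notin> M"
    using one M.a_inv_closed[of "\<zero> \<ominus> \<one>"] by (auto simp: a_minus_def)
  then have "M +> \<zero> \<noteq> M +> \<one>" by (simp add: eq_iff)
  moreover have "\<zero> \<ominus> \<ominus> \<one> = \<one>" by algebra
  then have "M +> \<zero> \<noteq> M +> \<ominus> \<one>" using one by (simp add: eq_iff)
  moreover have "\<one> \<ominus> \<ominus> \<one> = \<one> \<oplus> \<one>" by algebra
  then have "M +> \<one> = M +> \<ominus> \<one> \<longleftrightarrow> \<one> \<oplus> \<one> \<in> M" by (simp add: eq_iff)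
  ultimately show ?thesis
    using carrier_Quot_maximalideal[OF M residue] by (auto simp: card_insert_if)
qed

section \<open>Odd multiples and rings of even order\<close>

lemma add_pow_card_eq_zero:
  assumes I: "ideal I R" and "x \<in> I"
  shows "add_pow R (card I) x = \<zero>"
proof -
  interpret I: ideal I R by fact
  interpret S: group "add_monoid R\<lparr>carrier := I\<rparr>"
    using add.subgroup_imp_group[OF I.a_subgroup] by simp
  show ?thesis
    using S.pow_order_eq_1[of x] \<open>x \<in> I\<close> by (simp add: order_def add_pow_def nat_pow_def)
qed

text \<open>Oddness of an order enters in this form: modulo any ideal containing \<open>2 x\<close>,
  an odd multiple of \<open>x\<close> is \<open>x\<close> itself.\<close>

lemma add_pow_Suc_double:
  assumes "x \<in> carrier R"
  shows "add_pow R (Suc (2 * t)) x = add_pow R t (x \<oplus> x) \<oplus> x"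
proof -
  have "add_pow R t (x \<oplus> x) = add_pow R (2 * t) x"
    using assms add.nat_pow_distrib[of x x t] by (simp add: add.nat_pow_mult mult_2)
  then show ?thesis by simp
qed

text \<open>The multiple \<open>u\<close> of 1 by the odd number \<open>|M|\<close> is 1 modulo
  every maximal ideal, because 2 is 0 there; so \<open>u\<close> is a unit. By Lagrange it
  annihilates \<open>M\<close>.\<close>

lemma maximalideal_eq_zero:
  assumes two: "\<And>N. maximalideal N R \<Longrightarrow> \<one> \<oplus> \<one> \<in> N"
    and M: "maximalideal M R" and odd: "odd (card M)"
  shows "M = {\<zero>}"
proof -
  interpret M: maximalideal M R by fact
  obtain t where t: "card M = Suc (2 * t)" using odd by (auto elim: oddE)
  define u where "u = add_pow R (card M) \<one>"
  have u_eq: "u = (add_pow R t \<one>) \<otimes> (\<one> \<oplus> \<one>) \<oplus> \<one>"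
    using add_pow_Suc_double[of \<one> t] by (simp add: u_def t add_pow_ldistr)
  have "u \<in> Units R"
  proof (rule ccontr)
    assume "u \<notin> Units R"
    then obtain N where N: "maximalideal N R" "u \<in> N"
      using nonunit_iff[of u] by (auto simp: u_def)
    interpret N: maximalideal N R by (rule N(1))
    have "(add_pow R t \<one>) \<otimes> (\<one> \<oplus> \<one>) \<in> N" using two[OF N(1)] N.I_l_closed by simp
    then have "u \<ominus> (add_pow R t \<one>) \<otimes> (\<one> \<oplus> \<one>) \<in> N" using N(2) by (simp add: a_minus_def)
    moreover have "u \<ominus> (add_pow R t \<one>) \<otimes> (\<one> \<oplus> \<one>) = \<one>"
    proof -
      have "add_pow R t \<one> \<in> carrier R" by simp
      then show ?thesis unfolding u_eq by algebra
    qed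
    ultimately show False using maximalideal_one_notin[OF N(1)] by simp
  qed
  have "x = \<zero>" if "x \<in> M" for x
  proof -
    have x: "x \<in> carrier R" using that by (rule M.Icarr)
    have "u \<otimes> x = add_pow R (card M) x" using x by (simp add: u_def add_pow_ldistr)
    also have "\<dots> = \<zero>" using add_pow_card_eq_zero[OF M.ideal_axioms that] .
    finally have "inv u \<otimes> (u \<otimes> x) = \<zero>" using \<open>u \<in> Units R\<close> by simp
    then show ?thesis
      using \<open>u \<in> Units R\<close> x by (metis Units_closed Units_inv_closed Units_l_inv l_one m_assoc)
  qed
  then show ?thesis using M.zero_closed by blast
qed

lemma iso_ZFact_2_of_even:
  assumes even: "\<forall>x\<in>pverts (jacobson_graph R). even (out_degree (with_proj (jacobson_graph R)) x)"
    and card: "even (card (carrier R))"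
  shows "R \<simeq> ZFact 2"
proof -
  note residue = residue_field_elements[OF even]
  \<comment> \<open>\<open>|R| = |R/N| |N|\<close> with \<open>|N|\<close> odd, so evenness of
    \<open>|R|\<close> excludes residue fields of order 3.\<close>
  have two: "\<one> \<oplus> \<one> \<in> N" if N: "maximalideal N R" for N
    using card_Quot_maximalideal[OF N residue[OF N]] odd_card_maximalideal[OF even N] card
      card_carrier_Quot_mult[OF maximalideal.axioms(1)[OF N]]
    by (metis even_mult_iff odd_numeral)
  obtain M where M: "maximalideal M R" using exists_maximalideal by blast
  have "M = {\<zero>}" using maximalideal_eq_zero[OF two M odd_card_maximalideal[OF even M]] by blast
  then have "card (carrier R) = 2"
    using card_carrier_Quot_mult[OF maximalideal.axioms(1)[OF M]] two[OF M]
      card_Quot_maximalideal[OF M residue[OF M]] by simp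
  then show ?thesis using card_prime_imp_iso_ZFact by simp
qed

section \<open>The quotient by the Jacobson radical and rings of odd order\<close>

lemma maximalideals_comaximal:
  assumes M: "maximalideal M R" and N: "maximalideal N R" and "M \<noteq> N"
  shows "M <+>\<^bsub>R\<^esub> N = carrier R"
proof -
  interpret M: maximalideal M R by fact
  interpret N: maximalideal N R by fact
  have ideal: "ideal (M <+>\<^bsub>R\<^esub> N) R"
    using M.ideal_axioms N.ideal_axioms by (rule add_ideals)
  have "m \<in> M <+>\<^bsub>R\<^esub> N" if "m \<in> M" for m
    using that M.Icarr N.zero_closed unfolding set_add_def' by (intro UN_I[of m] UN_I[of \<zero>]) auto
  moreover have "n \<in> M <+>\<^bsub>R\<^esub> N" if "n \<in> N" for n
    using that N.Icarr M.zero_closed unfolding set_add_def' by (intro UN_I[of \<zero>] UN_I[of n]) auto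
  moreover have "\<not> N \<subseteq> M"
    using maximalideal_subset_imp_eq[OF N M] \<open>M \<noteq> N\<close> by blast
  ultimately show ?thesis
    using M.I_maximal[OF ideal] ideal.Icarr[OF ideal] by blast
qed

lemma Quot_jacobson_radical_iso:
  assumes iso: "\<And>M. maximalideal M R \<Longrightarrow> R Quot M \<simeq> S"
  shows "R Quot (jacobson_radical R) \<simeq> RDirProd_list (replicate (card {M. maximalideal M R}) S)"
proof -
  define k where "k = card {M. maximalideal M R}"
  obtain I where I: "bij_betw I {0..<k} {M. maximalideal M R}"
    using ex_bij_betw_nat_finite[OF finite_maximalideals] by (auto simp: k_def)
  have "k > 0"
    using exists_maximalideal finite_maximalideals by (auto simp: k_def card_gt_0_iff)
  \<comment> \<open>The Chinese remainder theorem is indexed by \<open>0..n\<close>, so its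
    \<open>n\<close> is one less than the number of maximal ideals.\<close>
  then obtain n where n: "k = Suc n" by (cases k) auto
  have I_max: "maximalideal (I i) R" if "i \<le> n" for i
    using bij_betwE[OF I] that n by auto
  have "(\<Inter>i\<le>n. I i) = jacobson_radical R"
    using bij_betw_imp_surj_on[OF I] n atLeast0LessThan lessThan_Suc_atMost
    by (simp add: jacobson_radical_eq_Inter)
  moreover have "R Quot (\<Inter>i\<le>n. I i) \<simeq> RDirProd_list (map (\<lambda>i. R Quot (I i)) [0..<Suc n])"
  proof (rule chinese_remainder)
    show "ideal (I i) R" if "i \<le> n" for i
      using I_max[OF that] by (rule maximalideal.axioms(1))
    show "I i <+>\<^bsub>R\<^esub> I j = carrier R" if "i \<le> n" "j \<le> n" "i \<noteq> j" for i j
      using maximalideals_comaximal[OF I_max[OF that(1)] I_max[OF that(2)]] that n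
        inj_onD[OF bij_betw_imp_inj_on[OF I], of i j] by auto
  qed
  moreover have "RDirProd_list (map (\<lambda>i. R Quot (I i)) [0..<Suc n]) \<simeq>
      RDirProd_list (replicate k S)"
  proof (rule RDirProd_list_cong)
    show "list_all2 (\<simeq>) (map (\<lambda>i. R Quot (I i)) [0..<Suc n]) (replicate k S)"
      using iso I_max by (auto simp: list_all2_conv_all_nth n nth_append simp del: upt_Suc replicate_Suc)
  qed
  ultimately show ?thesis
    using ring_iso_trans by (auto simp: k_def)
qed

text \<open>With \<open>M\<close> as the only maximal ideal, adjacent vertices are inverse to each
  other modulo \<open>M\<close>, so walks from 1 never leave the coset of 1; but -1 is a vertex
  outside it.\<close>

lemma connected_imp_distinct_maximalideals:
  assumes conn: "connected (with_proj (jacobson_graph R))"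
    and M: "maximalideal M R" and two: "\<one> \<oplus> \<one> \<notin> M"
  shows "\<exists>N. maximalideal N R \<and> N \<noteq> M"
proof (rule ccontr)
  assume neg: "\<not> ?thesis"
  interpret M: maximalideal M R by fact
  interpret G: pair_graph "jacobson_graph R" by (rule jacobson_graph_is_pair_graph)
  have "{N. maximalideal N R} = {M}" using neg M by blast
  then have J: "jacobson_radical R = M" by (simp add: jacobson_radical_eq_Inter)
  have "\<ominus> \<one> \<notin> M"
    using maximalideal_one_notin[OF M] M.a_inv_closed[of "\<ominus> \<one>"] by auto
  then have "\<one> \<in> pverts (jacobson_graph R)" "\<ominus> \<one> \<in> pverts (jacobson_graph R)"
    using maximalideal_one_notin[OF M] by (simp_all add: jacobson_graph_def J)
  moreover have "strongly_connected (with_proj (jacobson_graph R))"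
    using conn G.pair_sym_arcs by (intro G.symmetric_connected_imp_strongly_connected)
  ultimately have "\<one> \<rightarrow>\<^sup>*\<^bsub>with_proj (jacobson_graph R)\<^esub> (\<ominus> \<one>)"
    by (auto simp: strongly_connected_def)
  then have "\<ominus> \<one> \<in> carrier R \<and> \<one> \<ominus> \<ominus> \<one> \<in> M"
  proof (induction rule: G.reachable_induct)
    case base
    show ?case by (simp add: a_minus_def r_neg)
  next
    case (step x y)
    then have xy: "x \<in> carrier R" "y \<in> carrier R" "\<one> \<ominus> x \<in> M" "\<one> \<ominus> x \<otimes> y \<notin> Units R"
      by (auto simp: jacobson_graph_def)
    then have "\<one> \<ominus> x \<otimes> y \<in> M"
      using nonunit_iff[of "\<one> \<ominus> x \<otimes> y"] neg by auto
    then have "(\<one> \<ominus> x \<otimes> y) \<ominus> (\<one> \<ominus> x) \<otimes> y \<in> M"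
      using xy M.I_r_closed by (simp add: a_minus_def)
    moreover have "(\<one> \<ominus> x \<otimes> y) \<ominus> (\<one> \<ominus> x) \<otimes> y = \<one> \<ominus> y"
      using xy(1,2) by algebra
    ultimately show ?case using xy by simp
  qed
  moreover have "\<one> \<ominus> \<ominus> \<one> = \<one> \<oplus> \<one>" by algebra
  ultimately show False using two by simp
qed

lemma Quot_iso_of_even:
  assumes even: "\<forall>x\<in>pverts (jacobson_graph R). even (out_degree (with_proj (jacobson_graph R)) x)"
    and card: "odd (card (carrier R))"
    and conn: "connected (with_proj (jacobson_graph R))"
  shows "\<exists>n\<ge>2. R Quot (jacobson_radical R) \<simeq> RDirProd_list (replicate n (ZFact 3))"
proof -
  note residue = residue_field_elements[OF even]
  have two: "\<one> \<oplus> \<one> \<notin> N" if N: "maximalideal N R" for N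
    using card_Quot_maximalideal[OF N residue[OF N]] card
      card_carrier_Quot_mult[OF maximalideal.axioms(1)[OF N]]
    by (metis even_mult_iff even_numeral)
  have "R Quot N \<simeq> ZFact 3" if N: "maximalideal N R" for N
  proof -
    have "card (carrier (R Quot N)) = 3"
      using card_Quot_maximalideal[OF N residue[OF N]] two[OF N] by simp
    then show ?thesis
      using ring.card_prime_imp_iso_ZFact[OF ideal.quotient_is_ring[OF maximalideal.axioms(1)[OF N]]]
      by simp
  qed
  then have "R Quot (jacobson_radical R) \<simeq>
      RDirProd_list (replicate (card {M. maximalideal M R}) (ZFact 3))"
    by (rule Quot_jacobson_radical_iso)
  moreover obtain M where M: "maximalideal M R" using exists_maximalideal by blast
  then obtain N where N: "maximalideal N R" "N \<noteq> M"
    using connected_imp_distinct_maximalideals[OF conn M two[OF M]] by blast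
  have "card {M, N} \<le> card {M. maximalideal M R}"
    using M N by (intro card_mono finite_maximalideals) auto
  then have "card {M. maximalideal M R} \<ge> 2" using N by simp
  ultimately show ?thesis by blast
qed

section \<open>Converse: even degrees and connectedness\<close>

lemma out_degree_eq_card_minus_1:
  assumes x: "x \<in> carrier R" "x \<notin> jacobson_radical R" and "\<one> \<ominus> x \<otimes> x \<notin> Units R"
  shows "out_degree (with_proj (jacobson_graph R)) x =
    card (carrier R) - card {y \<in> carrier R. \<one> \<ominus> x \<otimes> y \<in> Units R} - 1"
proof -
  \<comment> \<open>The count passes to the complement because an involution will pair off the
    \<open>y\<close> for which \<open>1 - x y\<close> is a unit. The final 1 accounts for
    \<open>x\<close>, which lies in its own nonunit set.\<close>
  have "{y \<in> carrier R. \<one> \<ominus> x \<otimes> y \<notin> Units R} =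
      carrier R - {y \<in> carrier R. \<one> \<ominus> x \<otimes> y \<in> Units R}" by blast
  moreover have "card (carrier R - {y \<in> carrier R. \<one> \<ominus> x \<otimes> y \<in> Units R}) =
      card (carrier R) - card {y \<in> carrier R. \<one> \<ominus> x \<otimes> y \<in> Units R}"
    using finite_carrier by (intro card_Diff_subset) auto
  ultimately show ?thesis
    using x assms(3) out_degree_jacobson_graph[of x] finite_carrier by simp
qed

text \<open>In a ring of order two 1 is the only vertex, so all degrees are 0 and connectedness is
  trivial.\<close>

lemma eulerian_of_iso_ZFact_2:
  assumes "R \<simeq> ZFact 2"
  shows "eulerian (jacobson_graph R)"
proof -
  interpret G: pair_graph "jacobson_graph R" by (rule jacobson_graph_is_pair_graph)
  interpret J: ideal "jacobson_radical R" R by (rule ideal_jacobson_radical)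
  have "card (carrier R) = 2"
    using ring_iso_imp_card_eq[OF assms] by (simp add: card_ZFact)
  moreover have "card {\<zero>, \<one>} = 2" using one_neq_zero by simp
  ultimately have carrier: "carrier R = {\<zero>, \<one>}"
    using finite_carrier by (intro card_subset_eq[symmetric]) auto
  have "\<one> \<notin> jacobson_radical R"
    using exists_maximalideal maximalideal_one_notin unfolding jacobson_radical_def by blast
  then have verts: "pverts (jacobson_graph R) = {\<one>}"
    using J.zero_closed unfolding pverts_jacobson_graph carrier by blast
  then have "out_arcs (with_proj (jacobson_graph R)) w = {}" if "w \<in> pverts (jacobson_graph R)" for w
    using that G.in_arcsD2 G.pair_no_loops by (fastforce simp: out_arcs_def)
  then have "even (out_degree (with_proj (jacobson_graph R)) w)"
    if "w \<in> pverts (jacobson_graph R)" for w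
    using that by (simp add: out_degree_def)
  moreover have "connected (with_proj (jacobson_graph R))"
    using verts by (intro G.connectedI) (auto intro!: G.reachable_mk_symmetricI)
  ultimately show ?thesis by (simp add: G.eulerian_iff_even_out_degree)
qed

lemma eq_if_double_eq:
  assumes odd: "odd (card (carrier R))" and x: "x \<in> carrier R" "x \<oplus> x = \<zero>"
  shows "x = \<zero>"
proof -
  obtain t where t: "card (carrier R) = Suc (2 * t)" using odd by (auto elim: oddE)
  have "add_pow R (card (carrier R)) x = add_pow R t (x \<oplus> x) \<oplus> x"
    unfolding t using x(1) by (rule add_pow_Suc_double)
  then show ?thesis
    using add_pow_card_eq_zero[OF oneideal x(1)] x by simp
qed

text \<open>The congruence says that every element is 0, 1 or -1 modulo each maximal ideal. It is
  the form in which the product of copies of \<open>ZFact 3\<close> enters the study of degrees and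
  connectedness.\<close>

context
  assumes cube: "\<And>x. x \<in> carrier R \<Longrightarrow> x \<otimes> (x \<otimes> x) \<ominus> x \<in> jacobson_radical R"
begin

lemma square_minus_one_mem:
  assumes M: "maximalideal M R" and x: "x \<in> carrier R" "x \<notin> M"
  shows "\<one> \<ominus> x \<otimes> x \<in> M"
proof -
  interpret M: maximalideal M R by fact
  have "x \<otimes> (x \<otimes> x) \<ominus> x \<in> M"
    using cube[OF x(1)] M by (simp add: jacobson_radical_def)
  then have "\<ominus> (x \<otimes> (x \<otimes> x) \<ominus> x) \<in> M" by simp
  moreover have "\<ominus> (x \<otimes> (x \<otimes> x) \<ominus> x) = x \<otimes> (\<one> \<ominus> x \<otimes> x)"
    using x(1) by algebra
  ultimately show ?thesis
    using x maximalideal_mult_mem_iff[OF M x(1), of "\<one> \<ominus> x \<otimes> x"] by simp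
qed

text \<open>Modulo a maximal ideal avoiding \<open>x\<close>, the reflection \<open>y \<mapsto> 2 x - y\<close> changes the sign of \<open>1 - x y\<close>.\<close>

lemma even_out_degree:
  assumes odd: "odd (card (carrier R))" and x: "x \<in> carrier R" "x \<notin> jacobson_radical R"
  shows "even (out_degree (with_proj (jacobson_graph R)) x)"
proof -
  let ?U = "{y \<in> carrier R. \<one> \<ominus> x \<otimes> y \<in> Units R}"
  obtain M where M: "maximalideal M R" "x \<notin> M"
    using x by (auto simp: jacobson_radical_def)
  have nonunit: "\<one> \<ominus> x \<otimes> x \<notin> Units R"
    using square_minus_one_mem[OF M(1) x(1) M(2)] nonunit_iff[of "\<one> \<ominus> x \<otimes> x"] M(1) x(1) by auto
  have "even (card ?U)"
  proof (rule even_card_involution)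
    show "finite ?U" using finite_carrier by simp
    fix y assume "y \<in> ?U"
    then have y: "y \<in> carrier R" "\<one> \<ominus> x \<otimes> y \<in> Units R" by auto
    let ?y = "x \<oplus> x \<ominus> y"
    show "x \<oplus> x \<ominus> ?y = y" using x(1) y(1) by algebra
    show "?y \<in> ?U"
    proof (rule ccontr)
      assume "?y \<notin> ?U"
      then obtain N where N: "maximalideal N R" "\<one> \<ominus> x \<otimes> ?y \<in> N"
        using x(1) y(1) nonunit_iff[of "\<one> \<ominus> x \<otimes> ?y"] by auto
      interpret N: maximalideal N R by (rule N(1))
      have "x \<notin> N"
        using one_minus_mult_mem_maximalidealD(1)[OF N(1) x(1) _ N(2)] x(1) y(1) by simp
      then have sq: "\<one> \<ominus> x \<otimes> x \<in> N"
        by (rule square_minus_one_mem[OF N(1) x(1)])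
      \<comment> \<open>The two values \<open>1 - x y\<close> and \<open>1 - x (2 x - y)\<close> add
        up to \<open>2 (1 - x x)\<close>, which is 0 modulo \<open>N\<close>.\<close>
      have "\<one> \<ominus> x \<otimes> y = (\<one> \<ominus> x \<otimes> x) \<oplus> (\<one> \<ominus> x \<otimes> x) \<ominus> (\<one> \<ominus> x \<otimes> ?y)"
        using x(1) y(1) by algebra
      also have "\<dots> \<in> N" using sq N(2) by (simp add: a_minus_def)
      finally show False
        using y N(1) x(1) nonunit_iff[of "\<one> \<ominus> x \<otimes> y"] by auto
    qed
    show "?y \<noteq> y"
    proof
      assume eq: "?y = y"
      \<comment> \<open>A fixed point satisfies \<open>2 (x - y) = 0\<close>, hence
        \<open>y = x\<close> as the order is odd; but \<open>1 - x x\<close> is a nonunit.\<close>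
      have "(x \<ominus> y) \<oplus> (x \<ominus> y) = ?y \<ominus> y" using x(1) y(1) by algebra
      also have "\<dots> = \<zero>" using eq y(1) by (simp add: a_minus_def r_neg)
      finally have "x \<ominus> y = \<zero>"
        by (rule eq_if_double_eq[OF odd minus_closed[OF x(1) y(1)]])
      then have "x = y" using x(1) y(1) by simp
      with nonunit y show False by simp
    qed
  qed
  \<comment> \<open>Odd minus even minus 1 is even; strictness keeps the natural subtraction from
    truncating.\<close>
  moreover have "x \<notin> ?U" using nonunit by simp
  then have "card ?U < card (carrier R)"
    using x(1) finite_carrier by (intro psubset_card_mono) auto
  ultimately show ?thesis
    using odd by (simp add: out_degree_eq_card_minus_1[OF x nonunit])
qed

text \<open>Every vertex \<open>x\<close> is at most two edges from 1. If \<open>x\<close> avoids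
  \<open>M\<close> and \<open>N\<close> is another maximal ideal, some \<open>y\<close> is
  \<open>x\<close> modulo \<open>M\<close> and 1 modulo \<open>N\<close>; then \<open>x y\<close> is
  1 modulo \<open>M\<close>, and \<open>y\<close> times 1 is 1 modulo \<open>N\<close>.\<close>

lemma connected_jacobson_graph:
  assumes several: "\<And>M. maximalideal M R \<Longrightarrow> \<exists>N. maximalideal N R \<and> N \<noteq> M"
  shows "connected (with_proj (jacobson_graph R))"
proof -
  interpret G: pair_graph "jacobson_graph R" by (rule jacobson_graph_is_pair_graph)
  let ?V = "pverts (jacobson_graph R)"
  have vertexI: "x \<in> ?V" if "x \<in> carrier R" "maximalideal M R" "x \<notin> M" for x M
    using that by (auto simp: pverts_jacobson_graph jacobson_radical_def)
  \<comment> \<open>Equal endpoints are allowed, since the intermediate vertex may coincide with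
    \<open>x\<close> or with 1.\<close>
  have reach: "x \<rightarrow>\<^sup>*\<^bsub>with_proj (jacobson_graph R)\<^esub> y"
    if "x \<in> carrier R" "y \<in> carrier R" "maximalideal M R" "\<one> \<ominus> x \<otimes> y \<in> M" for x y M
  proof (cases "x = y")
    case True
    then show ?thesis
      using vertexI[of x M] one_minus_mult_mem_maximalidealD(1)[of M x y] that by auto
  next
    case False
    have "x \<notin> M" "y \<notin> M"
      using one_minus_mult_mem_maximalidealD[of M x y] that by auto
    then have "(x, y) \<in> parcs (jacobson_graph R)"
      using False that vertexI[of x M] vertexI[of y M] nonunit_iff[of "\<one> \<ominus> x \<otimes> y"]
      by (auto simp: jacobson_graph_def)
    then show ?thesis by (intro G.reachable_adjI) simp
  qed
  have reach_one: "x \<rightarrow>\<^sup>*\<^bsub>with_proj (jacobson_graph R)\<^esub> \<one>" if xV: "x \<in> ?V" for x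
  proof -
    obtain M where x: "x \<in> carrier R" and M: "maximalideal M R" "x \<notin> M"
      using xV by (auto simp: pverts_jacobson_graph jacobson_radical_def)
    obtain N where N: "maximalideal N R" "N \<noteq> M" using several[OF M(1)] by blast
    interpret M: maximalideal M R by (rule M(1))
    interpret N: maximalideal N R by (rule N(1))
    obtain a where a: "a \<in> carrier R" "a \<ominus> x \<in> M" "a \<in> N"
      using exists_separating_element[OF M(1) x] N by blast
    obtain b where b: "b \<in> carrier R" "b \<ominus> \<one> \<in> N" "b \<in> M"
      using exists_separating_element[OF N(1) one_closed] M(1) N(2) by blast
    have "\<one> \<ominus> x \<otimes> (a \<oplus> b) = (\<one> \<ominus> x \<otimes> x) \<oplus> (\<ominus> x) \<otimes> ((a \<ominus> x) \<oplus> b)"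
      using x a(1) b(1) by algebra
    also have "\<dots> \<in> M"
      using square_minus_one_mem[OF M(1) x M(2)] a(2) b(3) x M.I_l_closed by simp
    finally have "x \<rightarrow>\<^sup>*\<^bsub>with_proj (jacobson_graph R)\<^esub> (a \<oplus> b)"
      using x a b M(1) by (intro reach[of x "a \<oplus> b" M]) auto
    also have "\<one> \<ominus> (a \<oplus> b) \<otimes> \<one> = \<ominus> ((b \<ominus> \<one>) \<oplus> a)"
      using a(1) b(1) by algebra
    then have "\<one> \<ominus> (a \<oplus> b) \<otimes> \<one> \<in> N" using a(3) b(2) by simp
    then have "(a \<oplus> b) \<rightarrow>\<^sup>*\<^bsub>with_proj (jacobson_graph R)\<^esub> \<one>"
      using a b N(1) by (intro reach[of "a \<oplus> b" \<one> N]) auto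
    finally show ?thesis .
  qed
  obtain M where "maximalideal M R" using exists_maximalideal by blast
  then have one: "\<one> \<in> ?V"
    using vertexI[of \<one> M] maximalideal_one_notin by simp
  show ?thesis
  proof (rule G.connectedI)
    fix x y assume xy: "x \<in> ?V" "y \<in> ?V"
    have "x \<rightarrow>\<^sup>*\<^bsub>with_proj (jacobson_graph R)\<^esub> \<one>" using xy(1) reach_one by simp
    also have "\<one> \<rightarrow>\<^sup>*\<^bsub>with_proj (jacobson_graph R)\<^esub> y"
      using symmetric_reachable[OF G.pair_sym_arcs reach_one[of y]] xy(2) by simp
    finally show "x \<rightarrow>\<^sup>*\<^bsub>mk_symmetric (with_proj (jacobson_graph R))\<^esub> y"
      by (rule G.reachable_mk_symmetricI)
  qed (use one in auto)
qed

end

text \<open>The cube identity is pulled back along the isomorphism and the quotient map;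
  \<open>n \<ge> 2\<close> provides a second maximal ideal.\<close>

lemma eulerian_of_Quot_iso:
  assumes odd: "odd (card (carrier R))" and n: "n \<ge> 2"
    and iso: "R Quot (jacobson_radical R) \<simeq> RDirProd_list (replicate n (ZFact 3))"
  shows "eulerian (jacobson_graph R)"
proof -
  interpret G: pair_graph "jacobson_graph R" by (rule jacobson_graph_is_pair_graph)
  interpret J: ideal "jacobson_radical R" R by (rule ideal_jacobson_radical)
  interpret h: ring_hom_ring R "R Quot (jacobson_radical R)" "\<lambda>x. jacobson_radical R +> x"
    by (rule J.rcos_ring_hom_ring)
  have cube: "x \<otimes> (x \<otimes> x) \<ominus> x \<in> jacobson_radical R" if x: "x \<in> carrier R" for x
  proof -
    have "jacobson_radical R +> x \<otimes> (x \<otimes> x) = jacobson_radical R +> x"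
      using ring_iso_cube[OF iso J.quotient_is_ring
          RDirProd_list_replicate_cube[OF cring.axioms(1)[OF ZFact_is_cring] ZFact_3_cube]
          h.hom_closed[OF x]] x by simp
    then show ?thesis
      using x quotient_eq_iff_same_a_r_cos[OF J.ideal_axioms] by simp
  qed
  \<comment> \<open>A single maximal ideal would be the Jacobson radical, with at most 3 cosets,
    while the quotient has order \<open>3 ^ n\<close>, at least 9.\<close>
  have "\<exists>N. maximalideal N R \<and> N \<noteq> M" if M: "maximalideal M R" for M
  proof (rule ccontr)
    assume neg: "\<not> ?thesis"
    then have "{N. maximalideal N R} = {M}" using M by blast
    then have J_eq: "jacobson_radical R = M" by (simp add: jacobson_radical_eq_Inter)
    have "a \<ominus> \<one> \<in> M \<or> a \<oplus> \<one> \<in> M" if "a \<in> carrier R" "a \<notin> M" for a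
      using square_minus_one_mem[OF cube M that] one_minus_square_mem_iff[OF M that(1)] by blast
    then have "card (carrier (R Quot M)) \<le> 3"
      using card_Quot_maximalideal[OF M] by simp
    moreover have "card (carrier (R Quot M)) = 3 ^ n"
      using ring_iso_imp_card_eq[OF iso] by (simp add: card_RDirProd_list_replicate card_ZFact J_eq)
    moreover have "(3::nat) ^ n \<ge> 3 ^ 2" using n by (intro power_increasing) auto
    ultimately show False by simp
  qed
  then have "connected (with_proj (jacobson_graph R))"
    by (intro connected_jacobson_graph cube)
  moreover have "even (out_degree (with_proj (jacobson_graph R)) x)"
    if "x \<in> pverts (jacobson_graph R)" for x
    using even_out_degree[OF cube odd] that by (simp add: pverts_jacobson_graph)
  ultimately show ?thesis by (simp add: G.eulerian_iff_even_out_degree)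
qed

lemma eulerian_imp_iso:
  assumes "eulerian (jacobson_graph R)"
  shows "R \<simeq> ZFact 2 \<or>
    (odd (card (carrier R)) \<and>
     (\<exists>n\<ge>2. R Quot (jacobson_radical R) \<simeq> RDirProd_list (replicate n (ZFact 3))))"
proof -
  interpret G: pair_graph "jacobson_graph R" by (rule jacobson_graph_is_pair_graph)
  have "connected (with_proj (jacobson_graph R))"
      "\<forall>x\<in>pverts (jacobson_graph R). even (out_degree (with_proj (jacobson_graph R)) x)"
    using assms by (simp_all add: G.eulerian_iff_even_out_degree)
  then show ?thesis
    using iso_ZFact_2_of_even Quot_iso_of_even by blast
qed

end

theorem theorem2p6:
  fixes R (structure)
  assumes "cring R" and "finite (carrier R)" and "\<one> \<noteq> \<zero>"
  shows "eulerian (jacobson_graph R) \<longleftrightarrow>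
    R \<simeq> ZFact 2 \<or>
    (odd (card (carrier R)) \<and>
     (\<exists>n\<ge>2. R Quot (jacobson_radical R) \<simeq> RDirProd_list (replicate n (ZFact 3))))"
proof -
  interpret finite_nonzero_cring R
    using assms by (simp add: finite_nonzero_cring_def finite_nonzero_cring_axioms_def)
  show ?thesis
    using eulerian_imp_iso eulerian_of_iso_ZFact_2 eulerian_of_Quot_iso by blast
qed

end
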